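(* There is an absolute constant $C>0$ such that the following holds. Let $n,m,k$ be positive integers with $nk\ge 2$, let $A\in\mathbb Z^{m\times n}$, $b\in\mathbb Z^m$ be such that $P=\{x\in\mathbb R^n \mid Ax\le b\}$ is a $[0,k]$-polytope, let $c\in\mathbb Z^n$, and let $x^0$ be a vertex of $P$. Then the preprocessing \& scaling algorithm with input $(P,c,x^0)$ generates a simplex path, i.e., a path along the edges of $P$ from $x^0$ to a vertex of $P$ maximizing $c^\top x$ over $P$, of length at most $C\, n^4 k\log(nk)$. (That is, the length is in $O(n^4k\log(nk))$.)
   Context: A lattice polytope is a polytope all of whose vertices have integer coordinates. A $[0,k]$-polytope in $\mathbb R^n$ is a lattice polytope contained in $[0,k]^n$. $\log$ denotes the logarithm in base $2$. Oracle: given a polytope $Q\subseteq\mathbb R^n$, a vector $w\in\mathbb Z^n$, and a vertex $v$ of $Q$, it either states that $v$ maximizes $w^\top x$ over $Q$ (when this is the case), or returns a vertex $v'$ of $Q$ adjacent to $v$ (i.e., joined to $v$ by an edge of $Q$) with $w^\top v'>w^\top v$. If $v$ is not optimal, any such adjacent vertex may be returned; the result holds for every choice. Basic algorithm$(Q,w,v)$: set $v^0:=v$; for $t=0,1,2,\dots$ call the oracle on $(Q,w,v^t)$; if it states that $v^t$ is optimal, return $v^t$; otherwise let $v^{t+1}$ be the vertex returned by the oracle. Scaling algorithm$(Q,w,v)$, for a $[0,k]$-polytope $Q$: let $\ell:=\lceil\log\|w\|_\infty\rceil$ (with $\ell:=0$ if $w=0$) and $w^t:=\lceil w/2^{\ell-t}\rceil$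 (componentwise) for $t=0,\dots,\ell$. Set $v^{(0)}:=v$, and for $t=0,\dots,\ell$ set $v^{(t+1)}:=$ basic algorithm$(Q,w^t,v^{(t)})$. Return $v^{(\ell+1)}$. Preprocessing algorithm (Frank and Tardos): given $c\in\mathbb Q^n$ and a positive integer $N$, it returns a vector $\breve c\in\mathbb Z^n$ such that $\|\breve c\|_\infty\le 2^{4n^3}N^{n(n+2)}$ and $\operatorname{sign}(c^\top z)=\operatorname{sign}(\breve c^\top z)$ for every $z\in\mathbb Z^n$ with $\|z\|_1\le N-1$. Preprocessing \& scaling algorithm$(P,c,x^0)$: let $\breve c$ be the output of the preprocessing algorithm on $c$ and $N:=nk+1$; return $x^*:=$ scaling algorithm$(P,\breve c,x^0)$. The simplex path generated by an algorithm is the sequence of successive vertices obtained by concatenating all the oracle moves it performs; its length is the number of edges traversed (the number of oracle calls returning a new vertex). *)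

theory Defs
  imports "HOL-Analysis.Analysis" "HOL-Library.Function_Algebras"
begin

section \<open>Vectors\<close>

text \<open>
  The constant in the main result is uniform in the dimension \<open>n\<close>, so \<open>n\<close> has to be
  quantified inside the formula and cannot be a type. We therefore realise \<open>\<real>\<^sup>n\<close>
  (and \<open>\<int>\<^sup>n\<close>, \<open>\<rat>\<^sup>n\<close>) as the functions on \<open>nat\<close> that vanish outside \<open>{0,\<dots>,n-1}\<close>. With the
  pointwise real vector space structure on functions, the library notions of
  polytopes, extreme points, faces and segments apply to subsets of this space.
\<close>

instantiation "fun" :: (type, real_vector) real_vector
begin

definition scaleR_fun :: "real \<Rightarrow> ('a \<Rightarrow> 'b) \<Rightarrow> 'a \<Rightarrow> 'b" where
  "scaleR_fun r f = (\<lambda>x. r *\<^sub>R f x)"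

instance
  by standard
    (auto simp: scaleR_fun_def fun_eq_iff scaleR_add_right scaleR_add_left)

end

definition coord_space :: "nat \<Rightarrow> (nat \<Rightarrow> 'a::zero) set" where
  "coord_space n = {x. \<forall>i\<ge>n. x i = 0}"

definition dot :: "nat \<Rightarrow> (nat \<Rightarrow> 'a::comm_semiring_0) \<Rightarrow> (nat \<Rightarrow> 'a) \<Rightarrow> 'a" where
  "dot n x y = (\<Sum>i<n. x i * y i)"

definition norm_1 :: "nat \<Rightarrow> (nat \<Rightarrow> int) \<Rightarrow> int" where
  "norm_1 n z = (\<Sum>i<n. \<bar>z i\<bar>)"

text \<open>Inserting \<open>0\<close> only matters for \<open>n = 0\<close>.\<close>

definition norm_inf :: "nat \<Rightarrow> (nat \<Rightarrow> int) \<Rightarrow> int" where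
  "norm_inf n w = Max (insert 0 ((\<lambda>i. \<bar>w i\<bar>) ` {..<n}))"


section \<open>Polytopes\<close>

definition polytope_in :: "nat \<Rightarrow> (nat \<Rightarrow> real) set \<Rightarrow> bool" where
  "polytope_in n Q \<longleftrightarrow> polytope Q \<and> Q \<subseteq> coord_space n"

definition lattice_polytope :: "nat \<Rightarrow> (nat \<Rightarrow> real) set \<Rightarrow> bool" where
  "lattice_polytope n Q \<longleftrightarrow>
     polytope_in n Q \<and> (\<forall>v. v extreme_point_of Q \<longrightarrow> (\<forall>i<n. v i \<in> \<int>))"

definition box_polytope :: "nat \<Rightarrow> nat \<Rightarrow> (nat \<Rightarrow> real) set \<Rightarrow> bool" where
  "box_polytope n k Q \<longleftrightarrow>
     lattice_polytope n Q \<and> (\<forall>x\<in>Q. \<forall>i<n. 0 \<le> x i \<and> x i \<le> real k)"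

definition polyhedron_of ::
  "nat \<Rightarrow> nat \<Rightarrow> (nat \<Rightarrow> nat \<Rightarrow> int) \<Rightarrow> (nat \<Rightarrow> int) \<Rightarrow> (nat \<Rightarrow> real) set" where
  "polyhedron_of m n A b =
     {x \<in> coord_space n. \<forall>i<m. dot n (\<lambda>j. real_of_int (A i j)) x \<le> real_of_int (b i)}"

text \<open>
  The library predicate \<open>edge_of\<close> is restricted to Euclidean spaces. An edge of a
  polytope is a one-dimensional face, that is, a face which is the segment between
  two distinct vertices.
\<close>

definition adjacent ::
  "(nat \<Rightarrow> real) set \<Rightarrow> (nat \<Rightarrow> real) \<Rightarrow> (nat \<Rightarrow> real) \<Rightarrow> bool" where
  "adjacent Q u v \<longleftrightarrow>
     u extreme_point_of Q \<and> v extreme_point_of Q \<and> u \<noteq> v \<and> closed_segment u v face_of Q"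

definition objective :: "nat \<Rightarrow> (nat \<Rightarrow> int) \<Rightarrow> (nat \<Rightarrow> real) \<Rightarrow> real" where
  "objective n w x = dot n (\<lambda>i. real_of_int (w i)) x"

definition maximizes ::
  "nat \<Rightarrow> (nat \<Rightarrow> int) \<Rightarrow> (nat \<Rightarrow> real) set \<Rightarrow> (nat \<Rightarrow> real) \<Rightarrow> bool" where
  "maximizes n w Q v \<longleftrightarrow> v \<in> Q \<and> (\<forall>y\<in>Q. objective n w y \<le> objective n w v)"

text \<open>A path along the edges of \<open>P\<close>, given by its vertices; it has \<open>length p - 1\<close> edges.\<close>

definition edge_path :: "(nat \<Rightarrow> real) set \<Rightarrow> (nat \<Rightarrow> real) list \<Rightarrow> bool" where
  "edge_path P p \<longleftrightarrow>
     p \<noteq> [] \<and> (\<forall>v\<in>set p. v extreme_point_of P) \<and>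
     (\<forall>i. Suc i < length p \<longrightarrow> adjacent P (p ! i) (p ! Suc i))"


section \<open>Improvement oracles and algorithms\<close>

datatype answer = Optimal | Improve "nat \<Rightarrow> real"

text \<open>
  Improvement oracles may answer the same query \<open>(Q, w, v)\<close> differently on different occasions.
  To cover all possible choices, they receive as an additional first argument the
  simplex path generated so far. This is enough to tell apart any two calls of one
  execution that do not return \<open>Optimal\<close>, because each of them extends the path;
  and \<open>Optimal\<close> is the only admissible answer when \<open>v\<close> is optimal, and is
  inadmissible otherwise.
\<close>

type_synonym improvement_oracle =
  "(nat \<Rightarrow> real) list \<Rightarrow> (nat \<Rightarrow> real) set \<Rightarrow> (nat \<Rightarrow> int) \<Rightarrow> (nat \<Rightarrow> real) \<Rightarrow> answer"

definition valid_oracle :: "improvement_oracle \<Rightarrow> bool" where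
  "valid_oracle orc \<longleftrightarrow>
     (\<forall>n h Q w v. polytope_in n Q \<longrightarrow> w \<in> coord_space n \<longrightarrow> v extreme_point_of Q \<longrightarrow>
        (case orc h Q w v of
           Optimal \<Rightarrow> maximizes n w Q v
         | Improve v' \<Rightarrow> adjacent Q v v' \<and> objective n w v < objective n w v'))"

text \<open>
  The algorithms take the simplex path \<open>p\<close> generated so far, whose last element is the
  current vertex, and return the extended path, or \<open>None\<close> if they do not terminate.
\<close>

partial_function (option) basic_algorithm ::
  "improvement_oracle \<Rightarrow> (nat \<Rightarrow> real) set \<Rightarrow> (nat \<Rightarrow> int) \<Rightarrow> (nat \<Rightarrow> real) list \<Rightarrow> (nat \<Rightarrow> real) list option"
where
  "basic_algorithm orc Q w p =
     (case orc p Q w (last p) of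
        Optimal \<Rightarrow> Some p
      | Improve v' \<Rightarrow> basic_algorithm orc Q w (p @ [v']))"

definition scaling_levels :: "nat \<Rightarrow> (nat \<Rightarrow> int) \<Rightarrow> nat" where
  "scaling_levels n w =
     (if norm_inf n w = 0 then 0 else nat \<lceil>log 2 (real_of_int (norm_inf n w))\<rceil>)"

definition scaled :: "nat \<Rightarrow> (nat \<Rightarrow> int) \<Rightarrow> nat \<Rightarrow> (nat \<Rightarrow> int)" where
  "scaled n w t = (\<lambda>i. \<lceil>real_of_int (w i) / 2 ^ (scaling_levels n w - t)\<rceil>)"

text \<open>\<open>scaling_path orc n Q w v t\<close> is the path generated up to the vertex \<open>v\<^bsup>(t)\<^esup>\<close>.\<close>

primrec scaling_path ::
  "improvement_oracle \<Rightarrow> nat \<Rightarrow> (nat \<Rightarrow> real) set \<Rightarrow> (nat \<Rightarrow> int) \<Rightarrow> (nat \<Rightarrow> real) \<Rightarrow> nat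
     \<Rightarrow> (nat \<Rightarrow> real) list option"
where
  "scaling_path orc n Q w v 0 = Some [v]"
| "scaling_path orc n Q w v (Suc t) =
     Option.bind (scaling_path orc n Q w v t) (basic_algorithm orc Q (scaled n w t))"

definition scaling_algorithm ::
  "improvement_oracle \<Rightarrow> nat \<Rightarrow> (nat \<Rightarrow> real) set \<Rightarrow> (nat \<Rightarrow> int) \<Rightarrow> (nat \<Rightarrow> real)
     \<Rightarrow> (nat \<Rightarrow> real) list option"
where
  "scaling_algorithm orc n Q w v = scaling_path orc n Q w v (Suc (scaling_levels n w))"

text \<open>Input of a preprocessing algorithm: the dimension, the rational vector, and \<open>N\<close>.\<close>

type_synonym preprocessor = "nat \<Rightarrow> (nat \<Rightarrow> rat) \<Rightarrow> nat \<Rightarrow> (nat \<Rightarrow> int)"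

definition valid_preprocessor :: "preprocessor \<Rightarrow> bool" where
  "valid_preprocessor pre \<longleftrightarrow>
     (\<forall>n c N. c \<in> coord_space n \<longrightarrow> N > 0 \<longrightarrow>
        pre n c N \<in> coord_space n \<and>
        norm_inf n (pre n c N) \<le> 2 ^ (4 * n ^ 3) * int N ^ (n * (n + 2)) \<and>
        (\<forall>z \<in> coord_space n. norm_1 n z \<le> int N - 1 \<longrightarrow>
           sgn (dot n c (\<lambda>i. of_int (z i))) = of_int (sgn (dot n (pre n c N) z))))"

definition preprocessing_scaling ::
  "preprocessor \<Rightarrow> improvement_oracle \<Rightarrow> nat \<Rightarrow> nat \<Rightarrow> (nat \<Rightarrow> real) set \<Rightarrow> (nat \<Rightarrow> int) \<Rightarrow> (nat \<Rightarrow> real)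
     \<Rightarrow> (nat \<Rightarrow> real) list option"
where
  "preprocessing_scaling pre orc n k P c x0 =
     scaling_algorithm orc n P (pre n (\<lambda>i. of_int (c i)) (n * k + 1)) x0"

end

theory Submission
  imports Defs
begin

text \<open>
  The vertices are integral, so every oracle move for an integral objective gains at least \<open>1\<close>.
  Componentwise, \<open>w\<^sup>t\<^sup>+\<^sup>1 = 2 w\<^sup>t - e\<close> with \<open>e \<in> {0,1}\<^sup>n\<close>; hence the vertex that was optimal for \<open>w\<^sup>t\<close>
  is within \<open>n k\<close> of the optimum for \<open>w\<^sup>t\<^sup>+\<^sup>1\<close>, and each of the \<open>\<ell> + 1\<close> phases makes at most \<open>n k\<close>
  moves. The Frank--Tardos bound gives \<open>\<ell> = O(n\<^sup>3 log (n k))\<close>. The final vertex also maximizes the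
  original objective: otherwise the oracle, queried with \<open>c\<close>, would name a better vertex, and the
  two objectives agree in sign on the difference of two vertices.
\<close>

section \<open>Objective values on a box polytope\<close>

lemma objective_diff:
  "objective n w x - objective n w y = (\<Sum>i<n. real_of_int (w i) * (x i - y i))"
  by (simp add: objective_def dot_def sum_subtractf right_diff_distrib)

lemma box_diff_le:
  assumes "box_polytope n k Q" "x \<in> Q" "y \<in> Q" "i < n"
  shows "\<bar>x i - y i\<bar> \<le> real k"
  using assms unfolding box_polytope_def by (smt (verit))

text \<open>Each summand is at most \<bar>a i\<bar> * k. The lemma serves twice: with the first
  scaled objective as weights, and with the rounding errors between consecutive scaled
  objectives.\<close>

lemma weighted_box_diff_le:
  assumes "box_polytope n k Q" "x \<in> Q" "y \<in> Q" and a: "\<And>i. i < n \<Longrightarrow> \<bar>a i\<bar> \<le> 1"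
  shows "(\<Sum>i<n. a i * (x i - y i)) \<le> real (n * k)"
proof -
  have "a i * (x i - y i) \<le> real k" if "i < n" for i
  proof -
    have "\<bar>a i\<bar> * \<bar>x i - y i\<bar> \<le> 1 * real k"
      using a[OF that] box_diff_le[OF assms(1-3) that] by (intro mult_mono) auto
    then show ?thesis
      using abs_ge_self[of "a i * (x i - y i)"] by (simp add: abs_mult)
  qed
  then have "(\<Sum>i<n. a i * (x i - y i)) \<le> (\<Sum>i<n. real k)"
    by (intro sum_mono) auto
  then show ?thesis by simp
qed

lemma objective_extreme_in_Ints:
  assumes "box_polytope n k Q" "v extreme_point_of Q"
  shows "objective n w v \<in> \<int>"
  using assms unfolding box_polytope_def lattice_polytope_def objective_def dot_def
  by (intro Ints_sum Ints_mult) auto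

section \<open>Edge paths and the basic algorithm\<close>

lemma edge_path_snoc:
  assumes "edge_path Q p" "adjacent Q (last p) v"
  shows "edge_path Q (p @ [v])"
  unfolding edge_path_def
proof (intro conjI ballI allI impI)
  fix u assume "u \<in> set (p @ [v])"
  then show "u extreme_point_of Q"
    using assms unfolding edge_path_def adjacent_def by auto
next
  fix i assume i: "Suc i < length (p @ [v])"
  show "adjacent Q ((p @ [v]) ! i) ((p @ [v]) ! Suc i)"
  proof (cases "Suc i < length p")
    case True
    then show ?thesis using assms(1) unfolding edge_path_def by (simp add: nth_append)
  next
    case False
    then have "Suc i = length p" using i by simp
    moreover from this have "p ! i = last p"
      using last_conv_nth[of p] by (metis diff_Suc_1 length_0_conv nat.distinct(1))
    ultimately show ?thesis using assms(2) by (simp add: nth_append)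
  qed
qed simp

lemma edge_path_last_extreme:
  "edge_path Q p \<Longrightarrow> last p extreme_point_of Q"
  unfolding edge_path_def by simp

text \<open>\<open>d\<close> bounds the optimality gap of the current vertex. Every move closes at
  least 1 of it, so induction on \<open>d\<close>, over all paths \<open>p\<close>, gives
  termination and the bound on the moves together.\<close>

lemma basic_algorithm_terminates:
  assumes orc: "valid_oracle orc" and Q: "box_polytope n k Q" and w: "w \<in> coord_space n"
    and "edge_path Q p"
    and "\<And>y. y \<in> Q \<Longrightarrow> objective n w y - objective n w (last p) \<le> real d"
  shows "\<exists>q. basic_algorithm orc Q w p = Some q \<and> edge_path Q q \<and> hd q = hd p \<and>
           maximizes n w Q (last q) \<and> length q \<le> length p + d"
  using assms(4,5)
proof (induction d arbitrary: p)
  have ans: "case orc p Q w (last p) of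
           Optimal \<Rightarrow> maximizes n w Q (last p)
         | Improve v' \<Rightarrow> adjacent Q (last p) v' \<and> objective n w (last p) < objective n w v'"
    if "edge_path Q p" for p
    using orc Q w edge_path_last_extreme[OF that]
    unfolding valid_oracle_def box_polytope_def lattice_polytope_def by blast
  \<comment> \<open>Both objective values are integers, so a strict increase is one by at least
    1.\<close>
  have gain: "objective n w v' - objective n w (last p) \<ge> 1" "v' \<in> Q"
    if "edge_path Q p" "adjacent Q (last p) v'" "objective n w (last p) < objective n w v'"
    for p v'
  proof -
    have v': "v' extreme_point_of Q" using that(2) by (simp add: adjacent_def)
    then show "v' \<in> Q" by (simp add: extreme_point_of_def)
    show "objective n w v' - objective n w (last p) \<ge> 1"
      using objective_extreme_in_Ints[OF Q v', of w]
        objective_extreme_in_Ints[OF Q edge_path_last_extreme[OF that(1)], of w] that(3)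
      by (auto elim!: Ints_cases)
  qed
  {
    case 0
    \<comment> \<open>With gap 0 an \<open>Improve\<close> answer would contradict
      \<open>gain\<close>, so the answer is \<open>Optimal\<close>.\<close>
    then show ?case
      using ans[OF 0(1)] gain[OF 0(1)] basic_algorithm.simps[of orc Q w p]
      by (cases "orc p Q w (last p)") fastforce+
  next
    case (Suc d)
    show ?case
    proof (cases "orc p Q w (last p)")
      case Optimal
      then show ?thesis
        using ans[OF Suc.prems(1)] Suc.prems(1) basic_algorithm.simps[of orc Q w p] by simp
    next
      case (Improve v')
      then have adj: "adjacent Q (last p) v'"
        and less: "objective n w (last p) < objective n w v'"
        using ans[OF Suc.prems(1)] by auto
      have "\<exists>q. basic_algorithm orc Q w (p @ [v']) = Some q \<and> edge_path Q q \<and>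
          hd q = hd (p @ [v']) \<and> maximizes n w Q (last q) \<and> length q \<le> length (p @ [v']) + d"
      proof (rule Suc.IH)
        show "edge_path Q (p @ [v'])"
          using Suc.prems(1) adj by (rule edge_path_snoc)
        fix y assume "y \<in> Q"
        then show "objective n w y - objective n w (last (p @ [v'])) \<le> real d"
          using Suc.prems(2)[of y] gain(1)[OF Suc.prems(1) adj less] by simp
      qed
      \<comment> \<open>Needed to identify \<open>hd (p @ [v'])\<close> with
        \<open>hd p\<close>.\<close>
      moreover have "p \<noteq> []" using Suc.prems(1) by (simp add: edge_path_def)
      ultimately show ?thesis
        using Improve basic_algorithm.simps[of orc Q w p] by auto
    qed
  }
qed

section \<open>Scaled objectives and the phases of the scaling algorithm\<close>

lemma abs_le_norm_inf: "i < n \<Longrightarrow> \<bar>w i\<bar> \<le> norm_inf n w"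
  unfolding norm_inf_def by (intro Max_ge) auto

lemma norm_inf_nonneg: "0 \<le> norm_inf n w"
  unfolding norm_inf_def by (intro Max_ge) auto

lemma norm_inf_le_scaling_levels:
  "real_of_int (norm_inf n w) \<le> 2 ^ scaling_levels n w"
proof (cases "norm_inf n w = 0")
  case False
  then have pos: "norm_inf n w \<ge> 1" using norm_inf_nonneg[of n w] by linarith
  have "log 2 (norm_inf n w) \<le> real (scaling_levels n w)"
    using False unfolding scaling_levels_def by (simp add: real_nat_ceiling_ge)
  then show ?thesis
    using pos by (simp add: log_le_iff powr_realpow)
qed simp

lemma scaled_in_coord_space: "w \<in> coord_space n \<Longrightarrow> scaled n w t \<in> coord_space n"
  by (auto simp: coord_space_def scaled_def)

lemma scaled_scaling_levels: "scaled n w (scaling_levels n w) = w"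
  by (simp add: scaled_def)

text \<open>Dividing by 2 ^ \<open>scaling_levels n w\<close> brings every entry into [-1, 1], and
  rounding up stays there. Hence any starting vertex is within n * k of the optimum of the first
  phase.\<close>

lemma abs_scaled_0_le:
  assumes "i < n"
  shows "\<bar>scaled n w 0 i\<bar> \<le> 1"
proof -
  have "real_of_int \<bar>w i\<bar> \<le> real_of_int (norm_inf n w)"
    using abs_le_norm_inf[OF assms, of w] by linarith
  then have "\<bar>real_of_int (w i)\<bar> \<le> 2 ^ scaling_levels n w"
    using norm_inf_le_scaling_levels[of n w] unfolding of_int_abs by (rule order_trans)
  then have "\<bar>real_of_int (w i) / 2 ^ scaling_levels n w\<bar> \<le> 1"
    by (simp add: abs_divide)
  then show ?thesis
    unfolding scaled_def diff_zero by linarith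
qed

lemma scaled_Suc:
  assumes "t < scaling_levels n w"
  shows "2 * scaled n w t i - scaled n w (Suc t) i \<in> {0, 1}"
proof -
  define r where "r = scaling_levels n w - Suc t"
  \<comment> \<open>Natural subtraction truncates; t being below the last level makes the two
    exponents differ by exactly one.\<close>
  have r: "scaling_levels n w - t = Suc r" using assms by (simp add: r_def)
  define y where "y = real_of_int (w i) / 2 ^ Suc r"
  have "real_of_int (w i) / 2 ^ r = 2 * y" by (simp add: y_def)
  then have "scaled n w (Suc t) i = \<lceil>2 * y\<rceil>" "scaled n w t i = \<lceil>y\<rceil>"
    by (simp_all add: scaled_def r y_def flip: r_def)
  moreover have "\<lceil>2 * y\<rceil> \<le> 2 * \<lceil>y\<rceil>" "2 * \<lceil>y\<rceil> \<le> \<lceil>2 * y\<rceil> + 1"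
    by linarith+
  ultimately show ?thesis by auto
qed

lemma maximizes_scaled_imp_near_optimal:
  assumes Q: "box_polytope n k Q" and t: "t < scaling_levels n w"
    and v: "maximizes n (scaled n w t) Q v" and y: "y \<in> Q"
  shows "objective n (scaled n w (Suc t)) y - objective n (scaled n w (Suc t)) v \<le> real (n * k)"
proof -
  define e where "e i = real_of_int (2 * scaled n w t i - scaled n w (Suc t) i)" for i
  have e: "\<bar>e i\<bar> \<le> 1" for i
    using scaled_Suc[OF t, of i] by (auto simp: e_def)
  \<comment> \<open>The new weights are twice the old ones minus \<open>e\<close>; the minus sign is
    absorbed by swapping \<open>y\<close> and \<open>v\<close> in the error term.\<close>
  have "objective n (scaled n w (Suc t)) y - objective n (scaled n w (Suc t)) v
      = 2 * (objective n (scaled n w t) y - objective n (scaled n w t) v)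
        + (\<Sum>i<n. e i * (v i - y i))"
    unfolding objective_diff e_def sum_distrib_left sum.distrib[symmetric]
    by (intro sum.cong) (auto simp: algebra_simps)
  moreover have "(\<Sum>i<n. e i * (v i - y i)) \<le> real (n * k)"
    using v y by (intro weighted_box_diff_le[OF Q] e) (auto simp: maximizes_def)
  moreover have "2 * (objective n (scaled n w t) y - objective n (scaled n w t) v) \<le> 0"
    using v y by (simp add: maximizes_def)
  ultimately show ?thesis
    by (metis add_mono add_0)
qed

text \<open>Induction over the phases, each adding at most n * k vertices; the leading 1 counts the
  starting vertex. The optimum of one phase is a nearly optimal start for the next.\<close>

lemma scaling_path_terminates:
  assumes orc: "valid_oracle orc" and Q: "box_polytope n k Q" and w: "w \<in> coord_space n"
    and v: "v extreme_point_of Q" and "t \<le> scaling_levels n w"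
  shows "\<exists>q. scaling_path orc n Q w v (Suc t) = Some q \<and> edge_path Q q \<and> hd q = v \<and>
           maximizes n (scaled n w t) Q (last q) \<and> length q \<le> 1 + Suc t * (n * k)"
  using assms(5)
proof (induction t)
  case 0
  have path: "edge_path Q [v]" using v by (simp add: edge_path_def)
  have "objective n (scaled n w 0) y - objective n (scaled n w 0) (last [v]) \<le> real (n * k)"
    if "y \<in> Q" for y
    unfolding objective_diff
  proof (rule weighted_box_diff_le[OF Q that])
    show "last [v] \<in> Q" using v by (simp add: extreme_point_of_def)
    fix i assume "i < n"
    then show "\<bar>real_of_int (scaled n w 0 i)\<bar> \<le> 1" using abs_scaled_0_le[of i n w] by linarith
  qed
  from basic_algorithm_terminates[OF orc Q scaled_in_coord_space[OF w] path this]
  show ?case by auto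
next
  case (Suc t)
  then obtain p where p: "scaling_path orc n Q w v (Suc t) = Some p" "edge_path Q p" "hd p = v"
    "maximizes n (scaled n w t) Q (last p)" "length p \<le> 1 + Suc t * (n * k)"
    by auto
  have "t < scaling_levels n w" using Suc.prems by simp
  from basic_algorithm_terminates[OF orc Q scaled_in_coord_space[OF w] p(2)
      maximizes_scaled_imp_near_optimal[OF Q this p(4)]]
  obtain q where "basic_algorithm orc Q (scaled n w (Suc t)) p = Some q" "edge_path Q q"
    "hd q = hd p" "maximizes n (scaled n w (Suc t)) Q (last q)" "length q \<le> length p + n * k"
    by blast
  then show ?case
    using p scaling_path.simps(2)[of orc n Q w v "Suc t"] by auto
qed

text \<open>At the last level the divisor is 1, so the final phase optimizes \<open>w\<close>
  itself.\<close>

lemma scaling_algorithm_terminates: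
  assumes "valid_oracle orc" "box_polytope n k Q" "w \<in> coord_space n" "v extreme_point_of Q"
  shows "\<exists>q. scaling_algorithm orc n Q w v = Some q \<and> edge_path Q q \<and> hd q = v \<and>
           maximizes n w Q (last q) \<and> length q \<le> 1 + Suc (scaling_levels n w) * (n * k)"
  using scaling_path_terminates[OF assms order_refl]
  unfolding scaling_algorithm_def scaled_scaling_levels .

section \<open>Transfer from the preprocessed to the original objective\<close>

lemma valid_preprocessorD:
  assumes "valid_preprocessor pre" "c \<in> coord_space n" "N > 0"
  shows "pre n c N \<in> coord_space n"
    and "norm_inf n (pre n c N) \<le> 2 ^ (4 * n ^ 3) * int N ^ (n * (n + 2))"
    and "z \<in> coord_space n \<Longrightarrow> norm_1 n z \<le> int N - 1 \<Longrightarrow>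
      sgn (dot n c (\<lambda>i. of_int (z i))) = of_int (sgn (dot n (pre n c N) z))"
  using assms unfolding valid_preprocessor_def by simp_all

text \<open>The difference of two vertices is an integer vector of 1-norm at most n * k, which is N
  - 1 for N = n * k + 1; so the sign guarantee of the preprocessor covers it.\<close>

lemma sgn_objective_preprocessed:
  assumes pre: "valid_preprocessor pre" and Q: "box_polytope n k Q" and c: "c \<in> coord_space n"
    and u: "u extreme_point_of Q" and v: "v extreme_point_of Q"
  defines "w \<equiv> pre n (\<lambda>i. of_int (c i)) (n * k + 1)"
  shows "sgn (objective n c u - objective n c v) = sgn (objective n w u - objective n w v)"
proof -
  \<comment> \<open>The floor only changes the type: by integrality of the vertices it is exact for
    i < n, and beyond that it is 0.\<close>
  define z where "z i = \<lfloor>u i - v i\<rfloor>" for i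
  have uv: "u \<in> Q" "v \<in> Q" using u v by (simp_all add: extreme_point_of_def)
  have z: "real_of_int (z i) = u i - v i" if "i < n" for i
  proof -
    have "u i - v i \<in> \<int>"
      using that u v Q unfolding box_polytope_def lattice_polytope_def by (intro Ints_diff) auto
    then show ?thesis by (simp add: z_def)
  qed
  have "Q \<subseteq> coord_space n"
    using Q by (simp add: box_polytope_def lattice_polytope_def polytope_in_def)
  then have "u \<in> coord_space n" "v \<in> coord_space n"
    using uv by auto
  then have z_in: "z \<in> coord_space n"
    by (simp add: coord_space_def z_def)
  have "\<bar>z i\<bar> \<le> int k" if "i < n" for i
    using z[OF that] box_diff_le[OF Q uv that] by linarith
  then have "norm_1 n z \<le> (\<Sum>i<n. int k)"
    unfolding norm_1_def by (intro sum_mono) auto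
  then have "norm_1 n z \<le> int (n * k + 1) - 1" by simp
  moreover have "(\<lambda>i. rat_of_int (c i)) \<in> coord_space n"
    using c by (simp add: coord_space_def)
  ultimately have "sgn (dot n (\<lambda>i. rat_of_int (c i)) (\<lambda>i. of_int (z i))) = of_int (sgn (dot n w z))"
    unfolding w_def by (intro valid_preprocessorD(3)[OF pre] z_in) simp_all
  moreover have "dot n (\<lambda>i. rat_of_int (c i)) (\<lambda>i. of_int (z i)) = of_int (dot n c z)"
    by (simp add: dot_def)
  ultimately have "sgn (dot n c z) = sgn (dot n w z)"
    by (simp add: sgn_if split: if_splits)
  moreover have "objective n a u - objective n a v = real_of_int (dot n a z)" for a
    unfolding objective_diff dot_def of_int_sum of_int_mult
    by (intro sum.cong) (auto simp: z)
  ultimately show ?thesis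
    by (simp add: sgn_if split: if_splits)
qed

text \<open>Sign agreement is known only for pairs of vertices, while optimality compares with all
  points of \<open>Q\<close>. A query with objective \<open>c\<close>, made only inside the proof,
  bridges this: its answer is optimality or a better vertex.\<close>

lemma maximizes_preprocessed:
  assumes pre: "valid_preprocessor pre" and orc: "valid_oracle orc"
    and Q: "box_polytope n k Q" and c: "c \<in> coord_space n" and v: "v extreme_point_of Q"
    and max: "maximizes n (pre n (\<lambda>i. of_int (c i)) (n * k + 1)) Q v"
  shows "maximizes n c Q v"
proof -
  \<comment> \<open>Validity holds for every history, so the empty one will do.\<close>
  have ans: "case orc [] Q c v of Optimal \<Rightarrow> maximizes n c Q v
      | Improve v' \<Rightarrow> adjacent Q v v' \<and> objective n c v < objective n c v'"
    using orc Q c v unfolding valid_oracle_def box_polytope_def lattice_polytope_def by blast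
  show ?thesis
  proof (cases "orc [] Q c v")
    case Optimal
    then show ?thesis using ans by simp
  next
    case (Improve v')
    then have v': "v' extreme_point_of Q" and less: "objective n c v < objective n c v'"
      using ans by (auto simp: adjacent_def)
    have "v' \<in> Q" using v' by (simp add: extreme_point_of_def)
    then show ?thesis
      using sgn_objective_preprocessed[OF pre Q c v' v] less max
      by (auto simp: maximizes_def sgn_if split: if_splits)
  qed
qed

section \<open>Counting the phases\<close>

lemma scaling_levels_preprocessed_le:
  assumes pre: "valid_preprocessor pre" and c: "c \<in> coord_space n"
    and n: "n > 0" and nk: "n * k \<ge> 2"
  shows "real (Suc (scaling_levels n (pre n (\<lambda>i. of_int (c i)) (n * k + 1))))
    \<le> 12 * real n ^ 3 * log 2 (real (n * k))"
proof -
  define w where "w = pre n (\<lambda>i. of_int (c i)) (n * k + 1)"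
  define N where "N = n * k + 1"
  define L where "L = log 2 (real (n * k))"
  have "2 \<le> real (n * k)"
    using nk by (metis of_nat_le_iff of_nat_numeral)
  then have L: "L \<ge> 1" unfolding L_def by (subst le_log_iff) auto
  \<comment> \<open>This replaces log N by 2 * L, where n * k \<ge> 2 is essential.\<close>
  have "N \<le> (n * k)\<^sup>2"
  proof -
    have "n * k + 1 \<le> 2 * (n * k)" using nk by linarith
    also have "\<dots> \<le> (n * k)\<^sup>2" using nk by (simp only: power2_eq_square mult_le_mono1)
    finally show ?thesis by (simp only: N_def)
  qed
  then have "real N \<le> real (n * k) ^ 2"
    by (metis of_nat_le_iff of_nat_power)
  then have "log 2 (real N) \<le> log 2 (real (n * k) ^ 2)"
    by (intro log_mono) (simp_all add: N_def add_pos_nonneg)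
  also have "\<dots> = 2 * L" using nk by (simp add: L_def log_nat_power del: of_nat_mult)
  finally have logN: "log 2 (real N) \<le> 2 * L" .
  have "(\<lambda>i. rat_of_int (c i)) \<in> coord_space n"
    using c by (simp add: coord_space_def)
  then have bound: "norm_inf n w \<le> 2 ^ (4 * n ^ 3) * int N ^ (n * (n + 2))"
    unfolding w_def N_def by (rule valid_preprocessorD(2)[OF pre]) simp
  have n1: "1 \<le> real n" using n by simp
  have pows: "real n \<le> real n ^ 3" "real n ^ 2 \<le> real n ^ 3" "1 \<le> real n ^ 3"
    using n1 power_increasing[of 1 3 "real n"] power_increasing[of 2 3 "real n"]
      power_increasing[of 0 3 "real n"] by simp_all
  \<comment> \<open>The logarithm of the preprocessing bound, with 1 added for the ceiling.\<close>
  have "real (scaling_levels n w) \<le> 4 * real n ^ 3 + (real n ^ 2 + 2 * real n) * (2 * L) + 1"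
  proof (cases "norm_inf n w = 0")
    case True
    then show ?thesis using L by (simp add: scaling_levels_def)
  next
    case False
    then have pos: "norm_inf n w \<ge> 1" using norm_inf_nonneg[of n w] by linarith
    \<comment> \<open>Ensures that \<open>nat\<close> does not alter the ceiling.\<close>
    have "0 \<le> log 2 (real_of_int (norm_inf n w))" using pos by simp
    then have "real (scaling_levels n w) \<le> log 2 (real_of_int (norm_inf n w)) + 1"
      using False unfolding scaling_levels_def by simp
    moreover have "log 2 (real_of_int (norm_inf n w))
        \<le> log 2 (2 ^ (4 * n ^ 3) * real N ^ (n * (n + 2)))"
    proof (rule log_mono)
      have "real_of_int (norm_inf n w) \<le> real_of_int (2 ^ (4 * n ^ 3) * int N ^ (n * (n + 2)))"
        using bound by (simp only: of_int_le_iff)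
      then show "real_of_int (norm_inf n w) \<le> 2 ^ (4 * n ^ 3) * real N ^ (n * (n + 2))"
        by simp
    qed (use pos in auto)
    moreover have "log 2 (2 ^ (4 * n ^ 3) * real N ^ (n * (n + 2)))
        = 4 * real n ^ 3 + (real n ^ 2 + 2 * real n) * log 2 (real N)"
      by (simp add: log_mult log_nat_power N_def power2_eq_square distrib_left
          del: of_nat_mult of_nat_add power_Suc) (simp add: algebra_simps)
    moreover have "(real n ^ 2 + 2 * real n) * log 2 (real N)
        \<le> (real n ^ 2 + 2 * real n) * (2 * L)"
      using logN by (intro mult_left_mono) auto
    ultimately show ?thesis by linarith
  qed
  moreover have "(real n ^ 2 + 2 * real n) * (2 * L) \<le> (3 * real n ^ 3) * (2 * L)"
  proof (rule mult_right_mono)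
    show "real n ^ 2 + 2 * real n \<le> 3 * real n ^ 3" using pows by linarith
  qed (use L in simp)
  moreover have "real n ^ 3 \<le> real n ^ 3 * L"
    using L by (simp add: mult_le_cancel_left1)
  \<comment> \<open>12 = 4 + 6 + 2: the power of two, the power of N, and the two units from the
    ceiling and \<open>Suc\<close>, each unit being at most n ^ 3 * L.\<close>
  ultimately have "real (Suc (scaling_levels n w)) \<le> 12 * real n ^ 3 * L"
    using pows(3) unfolding of_nat_Suc by linarith
  then show ?thesis by (simp only: w_def L_def)
qed

section \<open>Assembling the path bound\<close>

theorem theorem1:
  shows "\<exists>C::real. C > 0 \<and>
    (\<forall>(pre::preprocessor) (orc::improvement_oracle) (n::nat) (m::nat) (k::nat)
       (A::nat \<Rightarrow> nat \<Rightarrow> int) (b::nat \<Rightarrow> int) (P::(nat \<Rightarrow> real) set)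
       (c::nat \<Rightarrow> int) (x0::nat \<Rightarrow> real).
       valid_preprocessor pre \<longrightarrow> valid_oracle orc \<longrightarrow>
       n > 0 \<longrightarrow> m > 0 \<longrightarrow> k > 0 \<longrightarrow> n * k \<ge> 2 \<longrightarrow>
       P = polyhedron_of m n A b \<longrightarrow> box_polytope n k P \<longrightarrow>
       c \<in> coord_space n \<longrightarrow> x0 extreme_point_of P \<longrightarrow>
       (\<exists>p. preprocessing_scaling pre orc n k P c x0 = Some p \<and>
            edge_path P p \<and> hd p = x0 \<and> maximizes n c P (last p) \<and>
            real (length p - 1) \<le> C * real n ^ 4 * real k * log 2 (real (n * k))))"
proof (intro exI[of _ 12] conjI allI impI)
  fix pre :: preprocessor and orc :: improvement_oracle and n m k :: nat
    and A :: "nat \<Rightarrow> nat \<Rightarrow> int" and b c :: "nat \<Rightarrow> int"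
    and P :: "(nat \<Rightarrow> real) set" and x0 :: "nat \<Rightarrow> real"
  assume pre: "valid_preprocessor pre" and orc: "valid_oracle orc" and n: "n > 0"
    and nk: "n * k \<ge> 2" and P: "box_polytope n k P" and c: "c \<in> coord_space n"
    and x0: "x0 extreme_point_of P"
  define w where "w = pre n (\<lambda>i. of_int (c i)) (n * k + 1)"
  have "(\<lambda>i. rat_of_int (c i)) \<in> coord_space n"
    using c by (simp add: coord_space_def)
  then have "w \<in> coord_space n"
    unfolding w_def by (rule valid_preprocessorD(1)[OF pre]) simp
  from scaling_algorithm_terminates[OF orc P this x0]
  obtain p where p: "scaling_algorithm orc n P w x0 = Some p" "edge_path P p" "hd p = x0"
    "maximizes n w P (last p)" "length p \<le> 1 + Suc (scaling_levels n w) * (n * k)"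
    by blast
  have "maximizes n c P (last p)"
    using maximizes_preprocessed[OF pre orc P c edge_path_last_extreme[OF p(2)]] p(4)
    by (simp add: w_def)
  moreover have "real (length p - 1) \<le> 12 * real n ^ 4 * real k * log 2 (real (n * k))"
  proof -
    \<comment> \<open>Number of phases times moves per phase; the list \<open>p\<close> has one
      vertex more than edges.\<close>
    have "length p - 1 \<le> Suc (scaling_levels n w) * (n * k)" using p(5) by linarith
    then have "real (length p - 1) \<le> real (Suc (scaling_levels n w)) * real (n * k)"
      by (metis of_nat_le_iff of_nat_mult)
    also have "\<dots> \<le> (12 * real n ^ 3 * log 2 (real (n * k))) * real (n * k)"
      using scaling_levels_preprocessed_le[OF pre c n nk] unfolding w_def
      by (intro mult_right_mono) auto
    also have "\<dots> = 12 * real n ^ 4 * real k * log 2 (real (n * k))"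
      by (simp add: power_numeral_reduce)
    finally show ?thesis .
  qed
  ultimately show "\<exists>p. preprocessing_scaling pre orc n k P c x0 = Some p \<and>
            edge_path P p \<and> hd p = x0 \<and> maximizes n c P (last p) \<and>
            real (length p - 1) \<le> 12 * real n ^ 4 * real k * log 2 (real (n * k))"
    using p unfolding preprocessing_scaling_def w_def by blast
qed simp

end
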